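(* Let $G$ be a 2-connected graph given with a pseudo-outerplanar diagram, whose vertices are $v_1,\dots,v_n$ in clockwise order on the circle. Let $C$ be a hamiltonian cycle of $G$ other than $v_1v_2\cdots v_nv_1$. Then $G$ has a hamiltonian diagram whose hamiltonian boundary is $C$. That is, $G$ has a pseudo-outerplanar drawing in which the vertices appear on the circle in the cyclic order given by $C$.
   Context: All graphs are finite, simple and undirected. A pseudo-outerplanar drawing of a 2-connected graph places its vertices on a circle and its edges inside the disk bounded by the circle, with each edge crossing at most one other edge. A pseudo-outerplanar diagram is such a drawing with the minimum possible number of crossings. A hamiltonian diagram is a pseudo-outerplanar drawing with vertices $u_1,\dots,u_n$ in cyclic order on the circle in which every $u_iu_{i+1}$ (indices mod $n$) is an edge. The cycle $u_1u_2\cdots u_nu_1$ is then called its hamiltonian boundary. *)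

theory Defs
  imports "HOL-Analysis.Analysis"
begin

section \<open>Graphs and cycles\<close>

definition simple_graph :: "'a set \<Rightarrow> 'a set set \<Rightarrow> bool" where
  "simple_graph V E \<longleftrightarrow> finite V \<and> (\<forall>e\<in>E. e \<subseteq> V \<and> card e = 2)"

definition connected_on :: "'a set set \<Rightarrow> 'a set \<Rightarrow> bool" where
  "connected_on E S \<longleftrightarrow>
     S \<noteq> {} \<and> (\<forall>x\<in>S. \<forall>y\<in>S. (x, y) \<in> {(u, w). u \<in> S \<and> w \<in> S \<and> {u, w} \<in> E}\<^sup>*)"

definition two_connected :: "'a set \<Rightarrow> 'a set set \<Rightarrow> bool" where
  "two_connected V E \<longleftrightarrow>
     card V \<ge> 3 \<and> connected_on E V \<and> (\<forall>v\<in>V. connected_on E (V - {v}))"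

text \<open>The edges of the closed sequence \<open>u\<^sub>1 u\<^sub>2 \<dots> u\<^sub>n u\<^sub>1\<close>. Cycles are identified with their edge
  sets, so the starting vertex and the direction of traversal are irrelevant.\<close>

definition cycle_edges :: "'a list \<Rightarrow> 'a set set" where
  "cycle_edges us = {{us ! i, us ! (Suc i mod length us)} | i. i < length us}"

definition hamiltonian_cycle :: "'a set \<Rightarrow> 'a set set \<Rightarrow> 'a set set \<Rightarrow> bool" where
  "hamiltonian_cycle V E C \<longleftrightarrow> C \<subseteq> E \<and>
     (\<exists>us. length us \<ge> 3 \<and> distinct us \<and> set us = V \<and> C = cycle_edges us)"

section \<open>Drawings in a disk\<close>

record 'a drawing =
  centre :: complex
  radius :: real
  pos :: "'a \<Rightarrow> complex"
  curve :: "'a set \<Rightarrow> real \<Rightarrow> complex"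

text \<open>Vertices are distinct points of the circle, edges are simple curves in the closed disk. As usual
  for drawings, an edge contains no vertex other than its two ends, and two edges have only finitely
  many points in common.\<close>

definition disk_drawing :: "'a set \<Rightarrow> 'a set set \<Rightarrow> 'a drawing \<Rightarrow> bool" where
  "disk_drawing V E D \<longleftrightarrow>
     radius D > 0 \<and> inj_on (pos D) V \<and> pos D ` V \<subseteq> sphere (centre D) (radius D) \<and>
     (\<forall>e\<in>E. arc (curve D e) \<and>
        {pathstart (curve D e), pathfinish (curve D e)} = pos D ` e \<and>
        path_image (curve D e) \<subseteq> cball (centre D) (radius D) \<and>
        path_image (curve D e) \<inter> pos D ` V = pos D ` e) \<and>
     (\<forall>e\<in>E. \<forall>f\<in>E. e \<noteq> f \<longrightarrow> finite (path_image (curve D e) \<inter> path_image (curve D f)))"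

text \<open>Any common point of two edges other than a common end counts as a crossing; touching is not
  treated separately.\<close>

definition crossing_points :: "'a drawing \<Rightarrow> 'a set \<Rightarrow> 'a set \<Rightarrow> complex set" where
  "crossing_points D e f =
     path_image (curve D e) \<inter> path_image (curve D f) - pos D ` (e \<inter> f)"

definition crosses :: "'a drawing \<Rightarrow> 'a set \<Rightarrow> 'a set \<Rightarrow> bool" where
  "crosses D e f \<longleftrightarrow> e \<noteq> f \<and> crossing_points D e f \<noteq> {}"

definition pseudo_outerplanar_drawing :: "'a set \<Rightarrow> 'a set set \<Rightarrow> 'a drawing \<Rightarrow> bool" where
  "pseudo_outerplanar_drawing V E D \<longleftrightarrow> disk_drawing V E D \<and>
     (\<forall>e\<in>E. \<forall>f\<in>E. \<forall>g\<in>E. crosses D e f \<and> crosses D e g \<longrightarrow> f = g)"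

text \<open>In a pseudo-outerplanar drawing no three edges share a crossing point, so counting crossings
  amounts to counting the points at which crossings occur.\<close>

definition crossing_count :: "'a set set \<Rightarrow> 'a drawing \<Rightarrow> nat" where
  "crossing_count E D = card (\<Union>e\<in>E. \<Union>f\<in>E - {e}. crossing_points D e f)"

definition pseudo_outerplanar_diagram :: "'a set \<Rightarrow> 'a set set \<Rightarrow> 'a drawing \<Rightarrow> bool" where
  "pseudo_outerplanar_diagram V E D \<longleftrightarrow> pseudo_outerplanar_drawing V E D \<and>
     (\<forall>D'. pseudo_outerplanar_drawing V E D' \<longrightarrow> crossing_count E D \<le> crossing_count E D')"

text \<open>Clockwise means decreasing argument, during less than one full turn.\<close>

definition clockwise_order :: "'a set \<Rightarrow> 'a drawing \<Rightarrow> 'a list \<Rightarrow> bool" where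
  "clockwise_order V D us \<longleftrightarrow> distinct us \<and> set us = V \<and>
     (\<exists>t :: nat \<Rightarrow> real.
        (\<forall>i < length us. pos D (us ! i) = centre D + complex_of_real (radius D) * cis (t i)) \<and>
        (\<forall>i j. i < j \<and> j < length us \<longrightarrow> t j < t i) \<and>
        (\<forall>i < length us. t 0 - 2 * pi < t i))"

text \<open>The hamiltonian boundary of such a diagram is \<open>cycle_edges us\<close>.\<close>

definition hamiltonian_diagram :: "'a set \<Rightarrow> 'a set set \<Rightarrow> 'a drawing \<Rightarrow> 'a list \<Rightarrow> bool" where
  "hamiltonian_diagram V E D us \<longleftrightarrow>
     pseudo_outerplanar_drawing V E D \<and> clockwise_order V D us \<and> cycle_edges us \<subseteq> E"

end

theory Submission
  imports Defs
begin

text \<open>Curves in a disk whose ends interleave on the circle must meet, so in the given drawing every edge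
  interleaves at most one other edge. Conversely, straight chords cross only if their ends interleave.
  It therefore suffices to show that in the cyclic order given by \<open>C\<close> every edge still interleaves at
  most one other edge.

  Let \<open>e\<close> and \<open>f\<close> interleave along \<open>C\<close> but not on the circle. Then two of the four segments into which
  their ends cut \<open>C\<close> have interleaving ends on the circle, so a step \<open>ac\<close> of one interleaves a step \<open>bd\<close> of
  the other. As \<open>ac\<close> and \<open>bd\<close> interleave nothing else, removing them from \<open>C\<close> leaves two paths, one from \<open>a\<close> to \<open>b\<close>
  and one from \<open>c\<close> to \<open>d\<close>, that occupy disjoint arcs of the circle, and the only further edges
  between these arcs are \<open>bc\<close> and \<open>da\<close>. So \<open>{e, f} = {bc, da}\<close>, both join neighbours on the circle
  and interleave nothing there, and \<open>e\<close> determines \<open>f\<close>.\<close>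

subsection \<open>Interleaving pairs\<close>

definition strictly_between :: "'b::linorder \<Rightarrow> 'b \<Rightarrow> 'b \<Rightarrow> bool" where
  "strictly_between a b c \<longleftrightarrow> a < c \<and> c < b \<or> b < c \<and> c < a"

text \<open>Separation of two pairs on a circle, read off after cutting the circle open at a point;
  the place of the cut does not matter. The general order type lets it serve both for angles and for
  positions along a cycle. It forces the four points to be distinct.\<close>

definition interleaved :: "'b::linorder \<Rightarrow> 'b \<Rightarrow> 'b \<Rightarrow> 'b \<Rightarrow> bool" where
  "interleaved a b c d \<longleftrightarrow> c \<notin> {a, b} \<and> d \<notin> {a, b} \<and> strictly_between a b c \<noteq> strictly_between a b d"

lemma interleaved_swap: "interleaved a b c d \<longleftrightarrow> interleaved c d a b"
  unfolding interleaved_def strictly_between_def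
  by (cases a b rule: linorder_cases; cases a c rule: linorder_cases; cases a d rule: linorder_cases;
      cases b c rule: linorder_cases; cases b d rule: linorder_cases; cases c d rule: linorder_cases; force)

lemma strictly_between_commute: "strictly_between b a c \<longleftrightarrow> strictly_between a b c"
  by (auto simp: strictly_between_def)

lemma interleaved_commute: "interleaved b a c d \<longleftrightarrow> interleaved a b c d" "interleaved a b d c \<longleftrightarrow> interleaved a b c d"
  by (auto simp: interleaved_def strictly_between_commute)

text \<open>Four points on a circle split into pairs in three ways, and the split into alternate
  points interleaves.\<close>

lemma interleaved_cases:
  fixes a b c d :: real
  assumes "distinct [a, b, c, d]"
  shows "interleaved a c b d \<or> interleaved a b c d \<or> interleaved b c d a"
  using assms unfolding interleaved_def strictly_between_def
  by (smt (verit) insert_iff empty_iff distinct.simps list.set)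

text \<open>The crossing chords \<open>a a'\<close> and \<open>b b'\<close> cut the circle into four
  arcs. The last hypothesis puts \<open>w\<close> on the arc from \<open>b\<close> to
  \<open>a'\<close> or on that from \<open>b'\<close> to \<open>a\<close>, hence off the arcs
  spanned by \<open>a b\<close> and \<open>a' b'\<close>.\<close>

lemma strictly_between_of_crossing:
  fixes a a' b b' w :: real
  assumes "interleaved a a' b b'" "w \<notin> {a, a', b, b'}"
    and "strictly_between a a' w = strictly_between a a' b \<and> strictly_between b b' w = strictly_between b b' a' \<or>
      strictly_between a a' w = strictly_between a a' b' \<and> strictly_between b b' w = strictly_between b b' a"
  shows "strictly_between a b w = strictly_between a b a'"
    and "strictly_between a' b' w = strictly_between a' b' a"
  using assms unfolding interleaved_def strictly_between_def by (smt (verit) insert_iff empty_iff)+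

section \<open>Walks among points of a circle\<close>

lemma step_change:
  fixes P :: "nat \<Rightarrow> bool"
  assumes "i \<le> j" "P i \<noteq> P j"
  obtains k where "i \<le> k" "k < j" "P k \<noteq> P (Suc k)"
proof (rule ccontr)
  assume "\<not> thesis"
  then have step: "P k = P (Suc k)" if "i \<le> k" "k < j" for k
    using that \<open>\<And>k. \<lbrakk>i \<le> k; k < j; P k \<noteq> P (Suc k)\<rbrakk> \<Longrightarrow> thesis\<close> by blast
  from \<open>i \<le> j\<close> have "P i = P j"
    by (induction rule: dec_induct) (use step in auto)
  with assms show False
    by blast
qed

text \<open>A discrete intermediate value argument, used once for each walk.\<close>

lemma interleaved_walks_cross:
  fixes x :: "nat \<Rightarrow> 'b::linorder"
  assumes "i \<le> j" "k \<le> l" "interleaved (x i) (x j) (x k) (x l)"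
    and disj: "\<And>m m'. i \<le> m \<Longrightarrow> m \<le> j \<Longrightarrow> k \<le> m' \<Longrightarrow> m' \<le> l \<Longrightarrow> x m \<noteq> x m'"
  obtains i' k' where "i \<le> i'" "i' < j" "k \<le> k'" "k' < l"
    "interleaved (x i') (x (Suc i')) (x k') (x (Suc k'))"
proof -
  have "strictly_between (x k) (x l) (x i) \<noteq> strictly_between (x k) (x l) (x j)"
    using assms(3) by (metis interleaved_def interleaved_swap)
  then obtain i' where i': "i \<le> i'" "i' < j"
    "strictly_between (x k) (x l) (x i') \<noteq> strictly_between (x k) (x l) (x (Suc i'))"
    using step_change[OF \<open>i \<le> j\<close>, of "\<lambda>m. strictly_between (x k) (x l) (x m)"] by blast
  then have "interleaved (x k) (x l) (x i') (x (Suc i'))"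
    using disj[of i'] disj[of "Suc i'"] \<open>k \<le> l\<close> by (auto simp: interleaved_def)
  then have "strictly_between (x i') (x (Suc i')) (x k) \<noteq> strictly_between (x i') (x (Suc i')) (x l)"
    by (metis interleaved_def interleaved_swap)
  then obtain k' where k': "k \<le> k'" "k' < l"
    "strictly_between (x i') (x (Suc i')) (x k') \<noteq> strictly_between (x i') (x (Suc i')) (x (Suc k'))"
    using step_change[OF \<open>k \<le> l\<close>, of "\<lambda>m. strictly_between (x i') (x (Suc i')) (x m)"] by blast
  moreover have "x i' \<noteq> x k'" "x (Suc i') \<noteq> x k'" "x i' \<noteq> x (Suc k')" "x (Suc i') \<noteq> x (Suc k')"
    using i' k'(1,2) by (intro disj; simp)+
  ultimately have "interleaved (x i') (x (Suc i')) (x k') (x (Suc k'))"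
    unfolding interleaved_def by (metis insertE singletonD)
  with i' k' that show ?thesis
    by blast
qed

text \<open>What the combinatorial argument retains: \<open>x\<close> gives the angles of the
  vertices along the hamiltonian cycle, \<open>F\<close> the edges as pairs of angles,
  \<open>cross_unique\<close> the pseudo-outerplanarity. A periodic sequence turns a change of
  starting vertex into an index shift.\<close>

locale closed_walk_chords =
  fixes n :: nat and x :: "nat \<Rightarrow> real" and F :: "real set set"
  assumes x_eq_iff: "x i = x j \<longleftrightarrow> i mod n = j mod n"
    and walk: "{x i, x (Suc i)} \<in> F"
    and cross_unique: "\<lbrakk>{a, b} \<in> F; {c, d} \<in> F; {c', d'} \<in> F; interleaved a b c d; interleaved a b c' d'\<rbrakk>
      \<Longrightarrow> {c, d} = {c', d'}"
begin

lemma shift: "closed_walk_chords n (\<lambda>i. x (i + k)) F"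
proof
  fix i j
  show "x (i + k) = x (j + k) \<longleftrightarrow> i mod n = j mod n"
    unfolding x_eq_iff
    by (auto simp: nat_mod_eq_iff)
next
  show "{x (i + k), x (Suc i + k)} \<in> F" for i
    using walk[of "i + k"] by simp
qed (rule cross_unique)

lemma period: "x n = x 0"
  by (simp add: x_eq_iff)

lemma x_eq: "i \<le> n \<Longrightarrow> j \<le> n \<Longrightarrow> x i = x j \<longleftrightarrow> i = j \<or> (i = 0 \<and> j = n) \<or> (i = n \<and> j = 0)"
  unfolding x_eq_iff by (cases "i = n"; cases "j = n") auto

end

text \<open>The chord of the step from \<open>x 0\<close> and that of the step from \<open>x k\<close> interleave, so no other chord interleaves
  either of them. Hence the vertices \<open>x 1, \<dots>, x k\<close> and \<open>x (k + 1), \<dots>, x n\<close> fill two opposite arcs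
  among the four arcs cut out by these two chords, and the other two arcs are empty.\<close>

locale crossing_walk = closed_walk_chords +
  fixes k :: nat
  assumes k: "1 < k" "Suc k < n"
    and cross: "interleaved (x 0) (x 1) (x k) (x (Suc k))"
begin

lemma interleaves_first_step:
  assumes "{a, b} \<in> F" "interleaved (x 0) (x 1) a b"
  shows "{a, b} = {x k, x (Suc k)}"
  by (metis One_nat_def assms cross cross_unique walk)

lemma interleaves_kth_step:
  assumes "{a, b} \<in> F" "interleaved (x k) (x (Suc k)) a b"
  shows "{a, b} = {x 0, x 1}"
  by (metis One_nat_def assms cross cross_unique interleaved_swap walk)

text \<open>A change of side between \<open>m\<close> and \<open>k\<close> would be a step
  interleaving the one from \<open>x 0\<close>, whose only partner is the step from
  \<open>x k\<close>. The next three lemmas argue alike for the other path and the other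
  step.\<close>

lemma side_of_first_step_low: "2 \<le> m \<Longrightarrow> m \<le> k \<Longrightarrow> strictly_between (x 0) (x 1) (x m) = strictly_between (x 0) (x 1) (x k)"
proof (rule ccontr)
  assume "2 \<le> m" "m \<le> k" "strictly_between (x 0) (x 1) (x m) \<noteq> strictly_between (x 0) (x 1) (x k)"
  then obtain i where i: "m \<le> i" "i < k" "strictly_between (x 0) (x 1) (x i) \<noteq> strictly_between (x 0) (x 1) (x (Suc i))"
    using step_change[of m k "\<lambda>m. strictly_between (x 0) (x 1) (x m)"] by blast
  then have "interleaved (x 0) (x 1) (x i) (x (Suc i))"
    using \<open>2 \<le> m\<close> k by (auto simp: interleaved_def x_eq)
  from interleaves_first_step[OF walk this] show False
    using i \<open>2 \<le> m\<close> k by (auto simp: doubleton_eq_iff x_eq)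
qed

lemma side_of_first_step_high:
  "Suc k \<le> m \<Longrightarrow> m < n \<Longrightarrow> strictly_between (x 0) (x 1) (x m) = strictly_between (x 0) (x 1) (x (Suc k))"
proof (rule ccontr)
  assume "Suc k \<le> m" "m < n" "strictly_between (x 0) (x 1) (x m) \<noteq> strictly_between (x 0) (x 1) (x (Suc k))"
  then obtain i where i: "Suc k \<le> i" "i < m" "strictly_between (x 0) (x 1) (x i) \<noteq> strictly_between (x 0) (x 1) (x (Suc i))"
    using step_change[of "Suc k" m "\<lambda>m. strictly_between (x 0) (x 1) (x m)"] by metis
  then have "interleaved (x 0) (x 1) (x i) (x (Suc i))"
    using \<open>m < n\<close> k by (auto simp: interleaved_def x_eq)
  from interleaves_first_step[OF walk this] show False
    using i \<open>m < n\<close> k by (auto simp: doubleton_eq_iff x_eq)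
qed

lemma side_of_kth_step_low:
  "1 \<le> m \<Longrightarrow> m < k \<Longrightarrow> strictly_between (x k) (x (Suc k)) (x m) = strictly_between (x k) (x (Suc k)) (x 1)"
proof (rule ccontr)
  assume "1 \<le> m" "m < k" "strictly_between (x k) (x (Suc k)) (x m) \<noteq> strictly_between (x k) (x (Suc k)) (x 1)"
  then obtain i where i: "1 \<le> i" "i < m"
    "strictly_between (x k) (x (Suc k)) (x i) \<noteq> strictly_between (x k) (x (Suc k)) (x (Suc i))"
    using step_change[of 1 m "\<lambda>m. strictly_between (x k) (x (Suc k)) (x m)"] by metis
  then have "interleaved (x k) (x (Suc k)) (x i) (x (Suc i))"
    using \<open>m < k\<close> k by (auto simp: interleaved_def x_eq)
  from interleaves_kth_step[OF walk this] show False
    using i \<open>m < k\<close> k by (auto simp: doubleton_eq_iff x_eq)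
qed

lemma side_of_kth_step_high:
  "Suc k < m \<Longrightarrow> m \<le> n \<Longrightarrow> strictly_between (x k) (x (Suc k)) (x m) = strictly_between (x k) (x (Suc k)) (x 0)"
proof (rule ccontr)
  assume "Suc k < m" "m \<le> n" "strictly_between (x k) (x (Suc k)) (x m) \<noteq> strictly_between (x k) (x (Suc k)) (x 0)"
  then obtain i where i: "m \<le> i" "i < n"
    "strictly_between (x k) (x (Suc k)) (x i) \<noteq> strictly_between (x k) (x (Suc k)) (x (Suc i))"
    using step_change[of m n "\<lambda>m. strictly_between (x k) (x (Suc k)) (x m)"] period by metis
  then have "interleaved (x k) (x (Suc k)) (x i) (x (Suc i))"
    using \<open>Suc k < m\<close> k by (auto simp: interleaved_def x_eq)
  from interleaves_kth_step[OF walk this] show False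
    using i \<open>Suc k < m\<close> k by (auto simp: doubleton_eq_iff x_eq)
qed

text \<open>An edge joining the two paths interleaves the step from \<open>x 0\<close> unless
  \<open>u = 1\<close> or \<open>v = n\<close>, and the step from \<open>x k\<close> unless
  \<open>u = k\<close> or \<open>v = Suc k\<close>. An edge that interleaves one of these steps must
  be the other step.\<close>

lemma chord_cases:
  assumes "{x u, x v} \<in> F" "1 \<le> u" "u \<le> k" "Suc k \<le> v" "v \<le> n"
  shows "u = 1 \<and> v = n \<or> u = k \<and> v = Suc k \<or> u = k \<and> v = n \<or> u = 1 \<and> v = Suc k"
proof -
  have A: "strictly_between (x 0) (x 1) (x k) \<noteq> strictly_between (x 0) (x 1) (x (Suc k))"
    using cross by (simp add: interleaved_def)
  have B: "strictly_between (x k) (x (Suc k)) (x 1) \<noteq> strictly_between (x k) (x (Suc k)) (x 0)"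
    using cross interleaved_swap by (metis interleaved_def)
  have "u = k \<and> v = Suc k" if "u \<noteq> 1" "v \<noteq> n"
  proof -
    have "interleaved (x 0) (x 1) (x u) (x v)"
      using that assms k A side_of_first_step_low[of u] side_of_first_step_high[of v] by (auto simp: interleaved_def x_eq)
    from interleaves_first_step[OF assms(1) this] show ?thesis
      using assms k by (auto simp: doubleton_eq_iff x_eq)
  qed
  moreover have "u = 1 \<and> v = n" if "u \<noteq> k" "v \<noteq> Suc k"
  proof -
    have "interleaved (x k) (x (Suc k)) (x u) (x v)"
      using that assms k B side_of_kth_step_low[of u] side_of_kth_step_high[of v] by (auto simp: interleaved_def x_eq)
    from interleaves_kth_step[OF assms(1) this] show ?thesis
      using assms k by (auto simp: doubleton_eq_iff x_eq)
  qed
  ultimately show ?thesis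
    using k assms by auto
qed

text \<open>Shaped to meet the disjunctive hypothesis of
  \<open>strictly_between_of_crossing\<close>.\<close>

lemma side_cases:
  assumes "m < n"
  shows "m \<in> {0, 1, k, Suc k} \<or> x m \<notin> {x 0, x 1, x k, x (Suc k)} \<and>
    (strictly_between (x 0) (x 1) (x m) = strictly_between (x 0) (x 1) (x k) \<and>
     strictly_between (x k) (x (Suc k)) (x m) = strictly_between (x k) (x (Suc k)) (x 1) \<or>
     strictly_between (x 0) (x 1) (x m) = strictly_between (x 0) (x 1) (x (Suc k)) \<and>
     strictly_between (x k) (x (Suc k)) (x m) = strictly_between (x k) (x (Suc k)) (x 0))"
proof (cases "m \<in> {0, 1, k, Suc k}")
  case False
  then have "x m \<notin> {x 0, x 1, x k, x (Suc k)}"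
    using assms k by (auto simp: x_eq)
  moreover have "2 \<le> m \<and> m \<le> k \<and> 1 \<le> m \<and> m < k \<or> Suc k \<le> m \<and> m < n \<and> Suc k < m \<and> m \<le> n"
    using False assms by auto
  ultimately show ?thesis
    using side_of_first_step_low side_of_first_step_high
      side_of_kth_step_low side_of_kth_step_high by blast
qed blast

text \<open>Each of the two chords spans one of the empty arcs, so all other vertices lie on one
  side of it.\<close>

lemma uncrossed:
  shows "\<not> interleaved (x 0) (x k) (x m) (x m')"
    and "\<not> interleaved (x 1) (x (Suc k)) (x m) (x m')"
proof -
  have *: "(x i = x 0 \<or> x i = x k \<or> strictly_between (x 0) (x k) (x i) = strictly_between (x 0) (x k) (x 1)) \<and>
      (x i = x 1 \<or> x i = x (Suc k) \<or>
        strictly_between (x 1) (x (Suc k)) (x i) = strictly_between (x 1) (x (Suc k)) (x 0))" for i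
  proof -
    have m: "i mod n < n" "x (i mod n) = x i"
      using k by (simp_all add: x_eq_iff)
    \<comment> \<open>The ends of the crossing steps are treated directly; \<open>side_cases\<close>
      covers the other vertices.\<close>
    have "strictly_between (x 0) (x k) (x (Suc k)) = strictly_between (x 0) (x k) (x 1) \<and>
      strictly_between (x 1) (x (Suc k)) (x k) = strictly_between (x 1) (x (Suc k)) (x 0)"
      using cross unfolding interleaved_def strictly_between_def
      by (smt (verit) insert_iff empty_iff)
    then show ?thesis
      using side_cases[OF m(1)] strictly_between_of_crossing[OF cross, of "x (i mod n)"] m(2)
      by (metis (no_types) empty_iff insert_iff)
  qed
  show "\<not> interleaved (x 0) (x k) (x m) (x m')"
    using *[of m] *[of m'] by (auto simp: interleaved_def)
  show "\<not> interleaved (x 1) (x (Suc k)) (x m) (x m')"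
    using *[of m] *[of m'] by (auto simp: interleaved_def)
qed

text \<open>The step into \<open>x k\<close> stays within the arc of the first path and the step
  into \<open>x 0\<close> within the arc of the second, and these arcs are disjoint. This will show
  that a chord cannot have a crossing of steps at both of its sides.\<close>

lemma not_interleaved_back:
  "\<not> interleaved (x (k - 1)) (x k) (x (n - 1)) (x 0)"
proof -
  have "x (k - 1) = x 1 \<or>
      strictly_between (x 0) (x 1) (x (k - 1)) = strictly_between (x 0) (x 1) (x k) \<and>
      strictly_between (x k) (x (Suc k)) (x (k - 1)) = strictly_between (x k) (x (Suc k)) (x 1) \<and>
      x (k - 1) \<notin> {x 0, x 1, x k, x (Suc k)}"
  proof (cases "k = 2")
    case False
    then have "x (k - 1) \<notin> {x 0, x 1, x k, x (Suc k)}"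
      using k by (auto simp: x_eq)
    with False k show ?thesis
      using side_of_first_step_low[of "k - 1"] side_of_kth_step_low[of "k - 1"] by auto
  qed simp
  moreover have "x (n - 1) = x (Suc k) \<or>
      strictly_between (x 0) (x 1) (x (n - 1)) = strictly_between (x 0) (x 1) (x (Suc k)) \<and>
      strictly_between (x k) (x (Suc k)) (x (n - 1)) = strictly_between (x k) (x (Suc k)) (x 0) \<and>
      x (n - 1) \<notin> {x 0, x 1, x k, x (Suc k)}"
  proof (cases "n = Suc (Suc k)")
    case False
    then have "x (n - 1) \<notin> {x 0, x 1, x k, x (Suc k)}"
      using k by (auto simp: x_eq)
    with False k show ?thesis
      using side_of_first_step_high[of "n - 1"] side_of_kth_step_high[of "n - 1"] by auto
  qed simp
  ultimately show ?thesis
    using cross unfolding interleaved_def strictly_between_def by (smt (verit) insert_iff empty_iff)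
qed

end

section \<open>Chords that interleave in the order of the walk\<close>

context closed_walk_chords
begin

text \<open>The segments from \<open>x 0\<close> to \<open>x p\<close> and from \<open>x q\<close>
  to \<open>x r\<close> have interleaving ends on the circle, so a step of one interleaves a step of
  the other. Both chords join the two paths left by these steps, and \<open>chord_cases\<close> with
  the order of the indices forces the steps to be those from \<open>x 0\<close> and
  \<open>x q\<close>.\<close>

lemma steps_interleave_at_ends:
  assumes ord: "0 < p" "p < q" "q < r" "r < n"
    and chords: "{x 0, x q} \<in> F" "{x p, x r} \<in> F"
    and sep: "interleaved (x 0) (x p) (x q) (x r)"
  shows "p = 1 \<and> r = Suc q \<and> crossing_walk n x F q"
proof -
  have disj: "x m \<noteq> x m'" if "0 \<le> m" "m \<le> p" "q \<le> m'" "m' \<le> r" for m m'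
    using that ord by (auto simp: x_eq)
  obtain i k where ik: "i < p" "q \<le> k" "k < r"
    and cross: "interleaved (x i) (x (Suc i)) (x k) (x (Suc k))"
    by (rule interleaved_walks_cross[of 0 p q r x]) (use ord sep disj in auto)
  interpret y: closed_walk_chords n "\<lambda>m. x (m + i)" F
    by (rule shift)
  interpret y: crossing_walk n "\<lambda>m. x (m + i)" F "k - i"
    using ik ord cross by unfold_locales (auto simp: Suc_diff_le)
  \<comment> \<open>In the shifted walk, \<open>x 0\<close> is reached as \<open>x n\<close>, at
    index \<open>n - i\<close> of the second path.\<close>
  have "i = 0 \<and> k = q"
    using y.chord_cases[of "q - i" "n - i"] chords(1) ik ord period
    by (simp add: insert_commute; linarith)
  moreover from this have "p = 1 \<and> r = Suc k"
    using y.chord_cases[of p r] chords(2) ik ord by auto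
  ultimately show ?thesis
    using y.crossing_walk_axioms by simp
qed

text \<open>One of three pairings of the four ends interleaves on the circle: that of the chords,
  that of the walk segments starting at \<open>x 0\<close> and \<open>x q\<close>, or that of the
  segments starting at \<open>x p\<close> and \<open>x r\<close>. A shift by \<open>p\<close>
  reduces the third to the second.\<close>

lemma interleaved_chord_cases:
  assumes ord: "0 < p" "p < q" "q < r" "r < n"
    and chords: "{x 0, x q} \<in> F" "{x p, x r} \<in> F"
  obtains "interleaved (x 0) (x q) (x p) (x r)"
  | "p = 1" "r = Suc q" "crossing_walk n x F q"
  | "q = Suc p" "n = Suc r" "crossing_walk n (\<lambda>m. x (m + p)) F (n - q)"
proof -
  have "distinct [x 0, x q, x p, x r]"
    using ord by (auto simp: x_eq)
  then consider "interleaved (x 0) (x q) (x p) (x r)" | "interleaved (x 0) (x p) (x q) (x r)"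
    | "interleaved (x q) (x p) (x r) (x 0)"
    using interleaved_cases by metis
  then show thesis
  proof cases
    case 2
    with steps_interleave_at_ends assms that show ?thesis
      by blast
  next
    case 3
    interpret y: closed_walk_chords n "\<lambda>m. x (m + p)" F
      by (rule shift)
    have "q - p = 1 \<and> n - p = Suc (r - p) \<and> crossing_walk n (\<lambda>m. x (m + p)) F (r - p)"
      by (rule y.steps_interleave_at_ends)
        (use ord chords 3 period in \<open>auto simp: insert_commute interleaved_commute\<close>)
    moreover from this have "q = Suc p" "n = Suc r" "r - p = n - q"
      using ord by auto
    ultimately show ?thesis
      using that by metis
  qed (use that in blast)
qed

text \<open>The chord from \<open>x 0\<close> to \<open>x q\<close> interleaves a chord in the order of the walk for one of three reasons. The
  last two both leave one side of it free of vertices, and they exclude each other.\<close>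

lemma interleaving_chord_unique_base:
  assumes ord: "0 < p" "p < q" "q < r" "r < n" "0 < p'" "p' < q" "q < r'" "r' < n"
    and chords: "{x 0, x q} \<in> F" "{x p, x r} \<in> F" "{x p', x r'} \<in> F"
  shows "{x p, x r} = {x p', x r'}"
proof -
  \<comment> \<open>A crossing at \<open>q\<close> makes the chord the first one of
    \<open>uncrossed\<close>; in the shifted walk below it is the second one, read
    backwards.\<close>
  have fwd: False if "crossing_walk n x F q" "interleaved (x 0) (x q) (x i) (x j)" for i j
    using crossing_walk.uncrossed(1) that by blast
  have bwd: False if "crossing_walk n (\<lambda>m. x (m + s)) F (n - q)" "q = Suc s"
    "interleaved (x 0) (x q) (x i) (x j)" for i j s
  proof -
    \<comment> \<open>Adding \<open>n\<close> before subtracting \<open>s\<close> avoids truncated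
      subtraction.\<close>
    have "x (i + n - s + s) = x i" "x (j + n - s + s) = x j"
      using that(2) ord by (simp_all add: x_eq_iff)
    then show False
      using crossing_walk.uncrossed(2)[OF that(1), of "i + n - s" "j + n - s"] that(2,3) ord period
      by (simp add: interleaved_commute)
  qed
  \<comment> \<open>The second crossing would make the steps into \<open>x q\<close> and into
    \<open>x 0\<close> interleave.\<close>
  have both: False if "crossing_walk n x F q" "crossing_walk n (\<lambda>m. x (m + s)) F (n - q)" "q = Suc s" for s
    using crossing_walk.not_interleaved_back[OF that(1)] crossing_walk.cross[OF that(2)] that(3) ord period
    by (simp add: Suc_diff_Suc)
  have first: "interleaved (x 0) (x q) (x p) (x r) \<or> p = 1 \<and> r = Suc q \<and> crossing_walk n x F q \<or>
      q = Suc p \<and> n = Suc r \<and> crossing_walk n (\<lambda>m. x (m + p)) F (n - q)"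
    using interleaved_chord_cases[OF ord(1-4) chords(1,2)] by metis
  have second: "interleaved (x 0) (x q) (x p') (x r') \<or> p' = 1 \<and> r' = Suc q \<and> crossing_walk n x F q \<or>
      q = Suc p' \<and> n = Suc r' \<and> crossing_walk n (\<lambda>m. x (m + p')) F (n - q)"
    using interleaved_chord_cases[OF ord(5-8) chords(1,3)] by metis
  from first show ?thesis
  proof (elim disjE conjE)
    assume *: "interleaved (x 0) (x q) (x p) (x r)"
    have "interleaved (x 0) (x q) (x p') (x r')"
      using second fwd[OF _ *] bwd[OF _ _ *] by blast
    then show ?thesis
      using cross_unique[OF chords *] by blast
  next
    assume *: "p = 1" "r = Suc q" "crossing_walk n x F q"
    have "p' = 1 \<and> r' = Suc q"
      using second fwd[OF *(3)] both[OF *(3)] by blast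
    with * show ?thesis
      by simp
  next
    assume *: "q = Suc p" "n = Suc r" "crossing_walk n (\<lambda>m. x (m + p)) F (n - q)"
    have "q = Suc p' \<and> n = Suc r'"
      using second bwd[OF *(3,1)] both[OF _ *(3,1)] by blast
    with * show ?thesis
      by simp
  qed
qed

text \<open>Rotating the walk to start at \<open>x i\<close> yields the index order required by
  \<open>interleaving_chord_unique_base\<close>; an end \<open>v\<close> before \<open>i\<close>
  reappears at \<open>v + n - i\<close>.\<close>

lemma interleaving_normal_form:
  assumes "i < j" "j < n" "k < n" "l < n" "interleaved i j k l"
  obtains p r where "0 < p" "p < j - i" "j - i < r" "r < n" "{x (p + i), x (r + i)} = {x k, x l}"
proof -
  have *: "\<exists>p r. 0 < p \<and> p < j - i \<and> j - i < r \<and> r < n \<and> {x (p + i), x (r + i)} = {x u, x v}"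
    if "i < u" "u < j" "v < i \<or> j < v" "v < n" for u v
  proof (cases "v < i")
    case True
    then show ?thesis
      using that assms by (intro exI[of _ "u - i"] exI[of _ "v + n - i"]) (auto simp: x_eq_iff)
  next
    case False
    then show ?thesis
      using that assms by (intro exI[of _ "u - i"] exI[of _ "v - i"]) auto
  qed
  have "i < k \<and> k < j \<and> (l < i \<or> j < l) \<or> i < l \<and> l < j \<and> (k < i \<or> j < k)"
    using assms by (auto simp: interleaved_def strictly_between_def)
  then show thesis
    using *[of k l] *[of l k] assms that by (metis insert_commute)
qed

text \<open>Carries \<open>cross_unique\<close> over from angles to positions along the walk, which
  is what redrawing along the cycle needs.\<close>

lemma interleaving_chord_unique:
  assumes "i < n" "j < n" "k < n" "l < n" "k' < n" "l' < n"
    and "interleaved i j k l" "interleaved i j k' l'"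
    and "{x i, x j} \<in> F" "{x k, x l} \<in> F" "{x k', x l'} \<in> F"
  shows "{x k, x l} = {x k', x l'}"
proof -
  have less: "{x k, x l} = {x k', x l'}"
    if ij: "i < j" "j < n" and il: "interleaved i j k l" "interleaved i j k' l'" and chord: "{x i, x j} \<in> F" for i j
  proof -
    obtain p r where pr: "0 < p" "p < j - i" "j - i < r" "r < n" "{x (p + i), x (r + i)} = {x k, x l}"
      using interleaving_normal_form[OF ij assms(3,4) il(1)] .
    obtain p' r' where pr': "0 < p'" "p' < j - i" "j - i < r'" "r' < n"
      "{x (p' + i), x (r' + i)} = {x k', x l'}"
      using interleaving_normal_form[OF ij assms(5,6) il(2)] .
    interpret y: closed_walk_chords n "\<lambda>m. x (m + i)" F
      by (rule shift)
    have "{x (p + i), x (r + i)} = {x (p' + i), x (r' + i)}"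
      by (rule y.interleaving_chord_unique_base[OF pr(1-4) pr'(1-4)])
        (use ij chord assms(10,11) pr(5) pr'(5) in auto)
    with pr pr' show ?thesis
      by simp
  qed
  have "i \<noteq> j"
    using assms(7) by (auto simp: interleaved_def strictly_between_def)
  then show ?thesis
    using less[of i j] less[of j i] assms by (metis insert_commute interleaved_commute(1) nat_neq_iff)
qed

end

subsection \<open>Paths in a disk with interleaving ends\<close>

text \<open>After identifying the plane with \<open>real^2\<close>, a box resting on the real axis
  contains both paths, and the Fashoda theorem applies with the ends alternating on its lower
  side.\<close>

lemma halfplane_paths_meet:
  fixes f g :: "real \<Rightarrow> complex"
  assumes "path f" "path g"
    and up: "\<And>z. z \<in> path_image f \<union> path_image g \<Longrightarrow> 0 \<le> Im z"
    and "Im (pathstart f) = 0" "Im (pathfinish f) = 0"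
    and "Im (pathstart g) = 0" "Im (pathfinish g) = 0"
    and "Re (pathstart f) < Re (pathstart g)" "Re (pathstart g) < Re (pathfinish f)"
      "Re (pathfinish f) < Re (pathfinish g)"
  shows "path_image f \<inter> path_image g \<noteq> {}"
proof -
  define v :: "complex \<Rightarrow> real^2" where "v z = vector [Re z, Im z]" for z
  have v: "v z $ 1 = Re z" "v z $ 2 = Im z" for z
    by (simp_all add: v_def)
  have inj: "z = z'" if "v z = v z'" for z z'
    using that v by (metis complex_eqI)
  have cont: "continuous_on S v" for S
  proof (rule continuous_on_componentwise[THEN iffD2], intro ballI)
    fix b :: "real^2" assume "b \<in> Basis"
    then obtain i where b: "b = axis i 1"
      by (auto simp: Basis_vec_def)
    have "(\<lambda>x. v x \<bullet> b) = Re \<or> (\<lambda>x. v x \<bullet> b) = Im"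
      using exhaust_2[of i] by (auto simp: b inner_axis v)
    then show "continuous_on S (\<lambda>x. v x \<bullet> b)"
      using continuous_on_Re[OF continuous_on_id, of S] continuous_on_Im[OF continuous_on_id, of S]
      by (elim disjE) (simp_all only:)
  qed
  have "compact (path_image f \<union> path_image g)"
    using assms by (intro compact_Un compact_path_image)
  then obtain B where B: "\<And>z. z \<in> path_image f \<union> path_image g \<Longrightarrow> norm z \<le> B"
    by (meson bounded_iff compact_imp_bounded)
  have box: "v z \<in> cbox (vector [-B, 0]) (vector [B, B])" if "z \<in> path_image f \<union> path_image g" for z
    using B[OF that] up[OF that] abs_Re_le_cmod[of z] abs_Im_le_cmod[of z]
    by (auto simp: mem_box_cart forall_2 v)
  obtain x where "x \<in> path_image (v \<circ> f)" "x \<in> path_image (v \<circ> g)"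
  proof (rule fashoda_interlace[of "v \<circ> f" "v \<circ> g" "vector [-B, 0]" "vector [B, B]"])
    show "path (v \<circ> f)" "path (v \<circ> g)"
      using assms cont by (auto intro: path_continuous_image)
    show "path_image (v \<circ> f) \<subseteq> cbox (vector [-B, 0]) (vector [B, B])"
      "path_image (v \<circ> g) \<subseteq> cbox (vector [-B, 0]) (vector [B, B])"
      using box by (auto simp: path_image_compose)
  qed (use assms in \<open>auto simp: pathstart_compose pathfinish_compose v\<close>)
  then obtain z z' where "z \<in> path_image f" "z' \<in> path_image g" "v z = v z'"
    by (auto simp: path_image_compose)
  then show ?thesis
    using inj by blast
qed

text \<open>The Cayley map with pole \<open>cis \<omega>\<close> takes the rest of the unit circle
  to the real line. Factoring out \<open>cis\<close> of the mean angle leaves cosine and sine of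
  half the difference.\<close>

lemma cayley_cis:
  assumes "sin ((\<theta> - \<omega>) / 2) \<noteq> 0"
  shows "\<i> * (cis \<omega> + cis \<theta>) / (cis \<omega> - cis \<theta>) = complex_of_real (- cot ((\<theta> - \<omega>) / 2))"
proof -
  define h where "h = (\<theta> - \<omega>) / 2"
  define s where "s = (\<theta> + \<omega>) / 2"
  have "\<omega> = s - h" "\<theta> = s + h"
    by (simp_all add: h_def s_def field_simps)
  then have "cis \<omega> = cis s * cis (-h)" "cis \<theta> = cis s * cis h"
    by (simp_all add: cis_mult)
  moreover have "cis (-h) + cis h = 2 * of_real (cos h)" "cis (-h) - cis h = - 2 * \<i> * of_real (sin h)"
    by (simp_all add: complex_eq_iff)
  ultimately have "cis \<omega> + cis \<theta> = cis s * (2 * of_real (cos h))"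
    "cis \<omega> - cis \<theta> = cis s * (- 2 * \<i> * of_real (sin h))"
    by (metis distrib_left, metis right_diff_distrib)
  moreover have "sin h \<noteq> 0"
    using assms by (simp add: h_def)
  ultimately have "\<i> * (cis \<omega> + cis \<theta>) / (cis \<omega> - cis \<theta>)
      = (cis s * (2 * \<i>) * of_real (cos h)) / (cis s * (2 * \<i>) * (- of_real (sin h)))"
    by (simp only: mult_ac) simp
  also have "\<dots> = of_real (cos h) / (- of_real (sin h))"
    by (subst mult_divide_mult_cancel_left) auto
  finally show ?thesis
    by (simp add: h_def cot_def)
qed

text \<open>The difference is \<open>sin (y - x) / (sin x * sin y)\<close>. The interval is where
  \<open>(\<theta> - \<omega>) / 2\<close> lies when \<theta> is less than a full turn below
  \<omega>.\<close>

lemma cot_strict_antimono: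
  fixes x y :: real
  assumes "- pi < x" "x < y" "y < 0"
  shows "cot y < cot x"
proof -
  have "sin x < 0" "sin y < 0"
    using assms sin_gt_zero[of "-x"] sin_gt_zero[of "-y"] by auto
  moreover have "0 < sin (y - x)"
    using assms by (intro sin_gt_zero) auto
  moreover have "cot x - cot y = sin (y - x) / (sin x * sin y)"
    using calculation by (simp add: cot_def sin_diff field_simps)
  ultimately show ?thesis
    by (smt (verit, best) divide_pos_pos mult_neg_neg)
qed

lemma cis_neq_less_2pi:
  assumes "\<bar>x - y\<bar> < 2 * pi" "x \<noteq> y"
  shows "cis x \<noteq> cis y"
proof
  assume "cis x = cis y"
  then have "cis (x - y) = 1"
    by (metis cis_divide cis_neq_zero divide_self)
  then have "cos (x - y) = 1"
    by (simp add: complex_eq_iff)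
  then obtain k :: int where "x - y = of_int k * 2 * pi"
    using cos_one_2pi_int by blast
  with assms have "\<bar>real_of_int k\<bar> < 1" "k \<noteq> 0"
    by (auto simp: abs_mult)
  then show False
    by linarith
qed

text \<open>The curves may run along the circle, but if they were disjoint they could not cover the circular arc
  from \<open>cis d\<close> to \<open>cis a\<close>. Sending an uncovered point of it to infinity turns the disk into a half-plane.\<close>

lemma disk_paths_meet_ordered:
  fixes f g :: "real \<Rightarrow> complex"
  assumes "path f" "path g"
    and disk: "path_image f \<union> path_image g \<subseteq> cball 0 1"
    and ends: "pathstart f = cis a" "pathstart g = cis b" "pathfinish f = cis c" "pathfinish g = cis d"
    and ord: "a < b" "b < c" "c < d" "d < a + 2 * pi"
  shows "path_image f \<inter> path_image g \<noteq> {}"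
proof
  assume disj: "path_image f \<inter> path_image g = {}"
  let ?A = "cis ` {d..a + 2 * pi}"
  have "connected ?A"
    by (intro connected_continuous_image continuous_intros) auto
  moreover have "closed (path_image f)" "closed (path_image g)"
    using assms closed_path_image by auto
  moreover have "cis (a + 2 * pi) = cis a"
    by (simp add: cis_mult[symmetric])
  then have "cis a \<in> path_image f \<inter> ?A"
    using ord ends pathstart_in_path_image[of f] by (auto simp: image_iff intro!: bexI[of _ "a + 2 * pi"])
  moreover have "cis d \<in> path_image g \<inter> ?A"
    using ord ends pathfinish_in_path_image[of g] by auto
  ultimately have "\<not> ?A \<subseteq> path_image f \<union> path_image g"
    using disj unfolding connected_closed by blast
  then obtain \<omega> where w: "cis \<omega> \<notin> path_image f \<union> path_image g" and "d \<le> \<omega>" "\<omega> \<le> a + 2 * pi"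
    by (auto simp: subset_iff)
  moreover have "\<omega> \<noteq> d" "\<omega> \<noteq> a + 2 * pi"
    using w \<open>cis d \<in> _\<close> \<open>cis a \<in> _\<close> \<open>cis (a + 2 * pi) = cis a\<close> by auto
  ultimately have \<omega>: "d < \<omega>" "\<omega> < a + 2 * pi"
    by auto
  define m where "m z = \<i> * (cis \<omega> + z) / (cis \<omega> - z)" for z
  have cont: "continuous_on (path_image f) m" "continuous_on (path_image g) m"
    using w unfolding m_def by (intro continuous_intros; force)+
  have ends_m: "m (cis \<theta>) = complex_of_real (- cot ((\<theta> - \<omega>) / 2))" if "a \<le> \<theta>" "\<theta> \<le> d" for \<theta>
    unfolding m_def
  proof (rule cayley_cis)
    have "0 < (\<omega> - \<theta>) / 2" "(\<omega> - \<theta>) / 2 < pi"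
      using that \<omega> by (simp_all add: field_simps)
    then have "0 < sin ((\<omega> - \<theta>) / 2)"
      by (rule sin_gt_zero)
    moreover have "(\<theta> - \<omega>) / 2 = - ((\<omega> - \<theta>) / 2)"
      by (simp add: field_simps)
    ultimately show "sin ((\<theta> - \<omega>) / 2) \<noteq> 0"
      by (metis less_irrefl neg_equal_0_iff_equal sin_minus)
  qed
  \<comment> \<open>The image moves to the right along the arc from \<open>a\<close> to
    \<open>d\<close>, since \<omega> lies beyond \<open>d\<close> and less than a full turn beyond
    \<open>a\<close>.\<close>
  have mono: "- cot ((\<theta> - \<omega>) / 2) < - cot ((\<theta>' - \<omega>) / 2)" if "a \<le> \<theta>" "\<theta> < \<theta>'" "\<theta>' \<le> d" for \<theta> \<theta>'
    using that \<omega> cot_strict_antimono[of "(\<theta> - \<omega>) / 2" "(\<theta>' - \<omega>) / 2"] by auto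
  \<comment> \<open>The imaginary part of \<open>m z\<close> is 1 - |z|^2 divided by the squared
    distance of \<open>z\<close> from the pole.\<close>
  have upper: "0 \<le> Im (m z)" if "norm z \<le> 1" "z \<noteq> cis \<omega>" for z
  proof -
    have "Re ((cis \<omega> + z) * cnj (cis \<omega> - z)) = 1 - (norm z)\<^sup>2"
      using sin_cos_squared_add3[of \<omega>]
      unfolding cmod_power2 by (simp add: algebra_simps power2_eq_square)
    moreover have "(norm z)\<^sup>2 \<le> 1"
      using that by (simp add: power_le_one)
    moreover have "Im (m z) = Re ((cis \<omega> + z) * cnj (cis \<omega> - z)) / (norm (cis \<omega> - z))\<^sup>2"
    proof -
      have "m z = \<i> * ((cis \<omega> + z) * cnj (cis \<omega> - z)) / complex_of_real ((norm (cis \<omega> - z))\<^sup>2)"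
        unfolding m_def by (subst complex_div_cnj) (simp only: mult.assoc of_real_power)
      then show ?thesis
        by (simp only: Im_divide_of_real Im_i_times)
    qed
    ultimately show ?thesis
      by simp
  qed
  have inj: "z = z'" if "m z = m z'" "z \<noteq> cis \<omega>" "z' \<noteq> cis \<omega>" for z z'
  proof -
    have "\<i> * (cis \<omega> + z) * (cis \<omega> - z') = \<i> * (cis \<omega> + z') * (cis \<omega> - z)"
      using that by (simp add: m_def frac_eq_eq del: mult_eq_0_iff)
    moreover have "\<i> * (cis \<omega> + z) * (cis \<omega> - z') - \<i> * (cis \<omega> + z') * (cis \<omega> - z)
        = \<i> * (2 * cis \<omega>) * (z - z')"
      by (simp add: algebra_simps)
    ultimately have "\<i> * (2 * cis \<omega>) * (z - z') = 0"
      by (metis right_minus_eq)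
    then show ?thesis
      by simp
  qed
  have "path_image (m \<circ> f) \<inter> path_image (m \<circ> g) \<noteq> {}"
  proof (rule halfplane_paths_meet)
    show "path (m \<circ> f)" "path (m \<circ> g)"
      using assms cont by (auto intro: path_continuous_image)
    show "0 \<le> Im z" if "z \<in> path_image (m \<circ> f) \<union> path_image (m \<circ> g)" for z
      using that disk w by (auto simp: path_image_compose subset_iff intro!: upper)
  qed (use ord mono in \<open>auto simp: pathstart_compose pathfinish_compose ends ends_m\<close>)
  then show False
    using disj inj w by (auto simp: path_image_compose)
qed

lemma interleaved_sorted:
  fixes a b c d :: real
  assumes "interleaved a b c d"
  obtains a' b' c' d' where "{a', b'} = {a, b}" "{c', d'} = {c, d}"
    "a' < c' \<and> c' < b' \<and> b' < d' \<or> c' < a' \<and> a' < d' \<and> d' < b'"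
proof -
  define a' b' where "a' = min a b" and "b' = max a b"
  have ab: "{a', b'} = {a, b}"
    by (auto simp: a'_def b'_def min_def max_def)
  have btw: "strictly_between a b w \<longleftrightarrow> a' < w \<and> w < b'" for w
    by (auto simp: a'_def b'_def strictly_between_def)
  have "c \<noteq> a'" "c \<noteq> b'" "d \<noteq> a'" "d \<noteq> b'" "(a' < c \<and> c < b') \<noteq> (a' < d \<and> d < b')"
    using assms ab by (auto simp: interleaved_def btw)
  then consider "a' < c \<and> c < b' \<and> b' < d \<or> c < a' \<and> a' < d \<and> d < b'"
    | "a' < d \<and> d < b' \<and> b' < c \<or> d < a' \<and> a' < c \<and> c < b'"
    by linarith
  then show thesis
    using that[OF ab] by cases (blast, metis insert_commute)
qed

text \<open>Edges determine their curves' ends only as a set; reversing a path where necessary gives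
  the ordered case.\<close>

lemma disk_paths_meet_unit:
  fixes f g :: "real \<Rightarrow> complex"
  assumes "path f" "path g" "path_image f \<union> path_image g \<subseteq> cball 0 1"
    and f: "{pathstart f, pathfinish f} = {cis a, cis c}"
    and g: "{pathstart g, pathfinish g} = {cis b, cis d}"
    and ord: "a < b" "b < c" "c < d" "d < a + 2 * pi"
  shows "path_image f \<inter> path_image g \<noteq> {}"
proof -
  obtain f' where f': "path f'" "path_image f' = path_image f" "pathstart f' = cis a" "pathfinish f' = cis c"
    using f assms(1) that[of f] that[of "reversepath f"] by (auto simp: doubleton_eq_iff)
  obtain g' where g': "path g'" "path_image g' = path_image g" "pathstart g' = cis b" "pathfinish g' = cis d"
    using g assms(2) that[of g] that[of "reversepath g"] by (auto simp: doubleton_eq_iff)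
  show ?thesis
    using disk_paths_meet_ordered[OF f'(1) g'(1) _ f'(3) g'(3) f'(4) g'(4) ord] f'(2) g'(2) assms(3)
    by simp
qed

text \<open>An affine map carries the disk to the unit disk. Sorting each pair of angles, and
  exchanging the paths if the smallest angle belongs to the second, reduces to
  \<open>disk_paths_meet_unit\<close>.\<close>

lemma disk_paths_meet:
  fixes f g :: "real \<Rightarrow> complex"
  assumes "path f" "path g" "path_image f \<union> path_image g \<subseteq> cball z r" "0 < r"
    and f: "{pathstart f, pathfinish f} = {z + of_real r * cis a, z + of_real r * cis b}"
    and g: "{pathstart g, pathfinish g} = {z + of_real r * cis c, z + of_real r * cis d}"
    and ord: "interleaved a b c d"
    and window: "\<And>s t. s \<in> {a, b, c, d} \<Longrightarrow> t \<in> {a, b, c, d} \<Longrightarrow> s < t + 2 * pi"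
  shows "path_image f \<inter> path_image g \<noteq> {}"
proof -
  define h :: "complex \<Rightarrow> complex" where "h w = (w - z) / of_real r" for w
  have cont: "continuous_on S h" for S
    unfolding h_def using \<open>0 < r\<close> by (intro continuous_intros) auto
  have h_cis: "h (z + of_real r * cis t) = cis t" for t
    using \<open>0 < r\<close> by (simp add: h_def)
  have h_inj: "h w = h w' \<longleftrightarrow> w = w'" for w w'
    using \<open>0 < r\<close> by (auto simp: h_def)
  have paths: "path (h \<circ> f)" "path (h \<circ> g)"
    using assms cont by (auto intro: path_continuous_image)
  have "norm (h w) \<le> 1" if "w \<in> cball z r" for w
    using that \<open>0 < r\<close> by (simp add: h_def norm_divide dist_norm norm_minus_commute)
  then have images: "path_image (h \<circ> f) \<union> path_image (h \<circ> g) \<subseteq> cball 0 1"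
    using assms(3) by (auto simp: path_image_compose)
  have "{pathstart (h \<circ> f), pathfinish (h \<circ> f)} = h ` {pathstart f, pathfinish f}"
    "{pathstart (h \<circ> g), pathfinish (h \<circ> g)} = h ` {pathstart g, pathfinish g}"
    by (simp_all add: pathstart_compose pathfinish_compose)
  then have ends: "{pathstart (h \<circ> f), pathfinish (h \<circ> f)} = {cis a, cis b}"
    "{pathstart (h \<circ> g), pathfinish (h \<circ> g)} = {cis c, cis d}"
    by (simp_all only: f g image_insert image_empty h_cis)
  have meet: "path_image p \<inter> path_image q \<noteq> {}"
    if "path p" "path q" "path_image p \<union> path_image q \<subseteq> cball 0 1"
      "{pathstart p, pathfinish p} = {cis a', cis b'}" "{pathstart q, pathfinish q} = {cis c', cis d'}"
      "a' < c'" "c' < b'" "b' < d'" "a' \<in> {a, b, c, d}" "d' \<in> {a, b, c, d}"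
    for p q a' b' c' d'
    using disk_paths_meet_unit[of p q a' b' c' d'] that window by blast
  obtain a' b' c' d' where eq: "{a', b'} = {a, b}" "{c', d'} = {c, d}"
    and *: "a' < c' \<and> c' < b' \<and> b' < d' \<or> c' < a' \<and> a' < d' \<and> d' < b'"
    using interleaved_sorted[OF ord] by blast
  have eqs: "{cis a', cis b'} = {cis a, cis b}" "{cis c', cis d'} = {cis c, cis d}"
    using arg_cong[OF eq(1), of "(`) cis"] arg_cong[OF eq(2), of "(`) cis"] by simp_all
  have mem: "a' \<in> {a, b, c, d}" "b' \<in> {a, b, c, d}" "c' \<in> {a, b, c, d}" "d' \<in> {a, b, c, d}"
    using eq by blast+
  from * have "path_image (h \<circ> f) \<inter> path_image (h \<circ> g) \<noteq> {}"
  proof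
    assume "a' < c' \<and> c' < b' \<and> b' < d'"
    then show ?thesis
      using meet[OF paths images] ends[folded eqs] mem by blast
  next
    assume "c' < a' \<and> a' < d' \<and> d' < b'"
    moreover have "path_image (h \<circ> g) \<union> path_image (h \<circ> f) \<subseteq> cball 0 1"
      using images by blast
    ultimately have "path_image (h \<circ> g) \<inter> path_image (h \<circ> f) \<noteq> {}"
      using meet[OF paths(2,1)] ends[folded eqs] mem by blast
    then show ?thesis
      by blast
  qed
  then show ?thesis
    by (auto simp: path_image_compose h_inj)
qed

subsection \<open>Straight chords\<close>

text \<open>An affine function of the point that vanishes on the line through \<open>cis s\<close> and \<open>cis t\<close>.\<close>

definition chord_side :: "real \<Rightarrow> real \<Rightarrow> complex \<Rightarrow> real" where
  "chord_side s t z = Re (z * cis (- ((s + t) / 2))) - cos ((s - t) / 2)"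

text \<open>The difference of cosines factors, so on the circle the sign can be read off from the
  two half-differences.\<close>

lemma chord_side_cis: "chord_side s t (cis \<theta>) = - 2 * sin ((\<theta> - s) / 2) * sin ((\<theta> - t) / 2)"
proof -
  have eqs: "\<theta> + - ((s + t) / 2) = (\<theta> - s) / 2 + (\<theta> - t) / 2" "(s - t) / 2 = (\<theta> - t) / 2 - (\<theta> - s) / 2"
    by (simp_all add: field_simps)
  have "chord_side s t (cis \<theta>) = cos ((\<theta> - s) / 2 + (\<theta> - t) / 2) - cos ((\<theta> - t) / 2 - (\<theta> - s) / 2)"
    by (simp only: chord_side_def cis_mult cis.sel eqs)
  then show ?thesis
    by (simp add: cos_add cos_diff)
qed

lemma sgn_sin_half:
  assumes "\<bar>x\<bar> < 2 * pi"
  shows "sgn (sin (x / 2)) = sgn x"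
  using sin_gt_zero[of "x / 2"] sin_gt_zero[of "- x / 2"] assms
  by (cases x "0::real" rule: linorder_cases) auto

text \<open>Half-differences stay strictly between -\<pi> and \<pi>, where sine has the sign of its
  argument.\<close>

lemma chord_side_sgn:
  assumes "\<bar>\<theta> - s\<bar> < 2 * pi" "\<bar>\<theta> - t\<bar> < 2 * pi"
  shows "chord_side s t (cis \<theta>) = 0 \<longleftrightarrow> \<theta> \<in> {s, t}"
    and "0 < chord_side s t (cis \<theta>) \<longleftrightarrow> strictly_between s t \<theta>"
proof -
  have "sgn (chord_side s t (cis \<theta>)) = - sgn (\<theta> - s) * sgn (\<theta> - t)"
    using sgn_sin_half[OF assms(1)] sgn_sin_half[OF assms(2)]
    by (simp add: chord_side_cis sgn_mult)
  then show "chord_side s t (cis \<theta>) = 0 \<longleftrightarrow> \<theta> \<in> {s, t}"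
    and "0 < chord_side s t (cis \<theta>) \<longleftrightarrow> strictly_between s t \<theta>"
    by (auto simp: sgn_if strictly_between_def split: if_splits)
qed

lemma chord_side_segment:
  "chord_side s t ((1 - u) *\<^sub>R a + u *\<^sub>R b) = (1 - u) * chord_side s t a + u * chord_side s t b"
  by (simp add: chord_side_def algebra_simps)

lemma chord_side_on_chord:
  assumes "z \<in> closed_segment (cis s) (cis t)"
  shows "chord_side s t z = 0"
  using assms by (auto simp: closed_segment_def chord_side_segment chord_side_cis)

text \<open>\<open>chord_side s t\<close> is affine along the second chord and vanishes at
  \<open>z\<close>. If one end is shared, that end is the only zero; if none is, both ends lie
  strictly on the same side and there is no zero.\<close>

lemma chords_meet:
  assumes z: "z \<in> closed_segment (cis s) (cis t)" "z \<in> closed_segment (cis u) (cis v)"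
    and window: "\<And>x y. x \<in> {s, t} \<Longrightarrow> y \<in> {u, v} \<Longrightarrow> \<bar>y - x\<bar> < 2 * pi"
    and "u \<noteq> v" "{s, t} \<noteq> {u, v}" "\<not> interleaved s t u v"
  shows "z \<in> cis ` ({s, t} \<inter> {u, v})"
proof -
  obtain l where l: "0 \<le> l" "l \<le> 1" and zl: "z = (1 - l) *\<^sub>R cis u + l *\<^sub>R cis v"
    using z(2) by (auto simp: closed_segment_def)
  let ?S = "chord_side s t"
  have 0: "(1 - l) * ?S (cis u) + l * ?S (cis v) = 0"
    using chord_side_on_chord[OF z(1)] by (simp add: zl chord_side_segment)
  have sgn_u: "?S (cis u) = 0 \<longleftrightarrow> u \<in> {s, t}" "0 < ?S (cis u) \<longleftrightarrow> strictly_between s t u"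
    and sgn_v: "?S (cis v) = 0 \<longleftrightarrow> v \<in> {s, t}" "0 < ?S (cis v) \<longleftrightarrow> strictly_between s t v"
    by (rule chord_side_sgn; rule window; simp)+
  consider "u \<in> {s, t}" "v \<notin> {s, t}" | "u \<notin> {s, t}" "v \<in> {s, t}" | "u \<notin> {s, t}" "v \<notin> {s, t}"
    using assms(4,5) by auto
  then show ?thesis
  proof cases
    case 1
    then have "l = 0"
      using 0 sgn_u sgn_v by auto
    with 1 zl show ?thesis
      by auto
  next
    case 2
    then have "l = 1"
      using 0 sgn_u sgn_v by auto
    with 2 zl show ?thesis
      by auto
  next
    case 3
    then have "?S (cis u) \<noteq> 0" "?S (cis v) \<noteq> 0" "0 < ?S (cis u) \<longleftrightarrow> 0 < ?S (cis v)"
      using sgn_u sgn_v assms(6) by (auto simp: interleaved_def)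
    then have "0 < ?S (cis u) \<and> 0 < ?S (cis v) \<or> 0 < - ?S (cis u) \<and> 0 < - ?S (cis v)"
      by auto
    then have False
    proof
      assume *: "0 < ?S (cis u) \<and> 0 < ?S (cis v)"
      then have "0 \<le> (1 - l) * ?S (cis u)" "0 \<le> l * ?S (cis v)"
        using l by auto
      with 0 have "(1 - l) * ?S (cis u) = 0" "l * ?S (cis v) = 0"
        by linarith+
      with * show False
        by auto
    next
      assume *: "0 < - ?S (cis u) \<and> 0 < - ?S (cis v)"
      then have "(1 - l) * ?S (cis u) \<le> 0" "l * ?S (cis v) \<le> 0"
        using l by (auto simp: mult_le_0_iff)
      with 0 have "(1 - l) * ?S (cis u) = 0" "l * ?S (cis v) = 0"
        by linarith+
      with * show False
        by auto
    qed
    then show ?thesis ..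
  qed
qed

text \<open>Two common points would make \<open>chord_side s t\<close> vanish along the whole second
  chord, so both chords would have the same ends.\<close>

lemma finite_chords_inter:
  assumes window: "\<And>x y. x \<in> {s, t} \<Longrightarrow> y \<in> {u, v} \<Longrightarrow> \<bar>y - x\<bar> < 2 * pi"
    and "u \<noteq> v" "{s, t} \<noteq> {u, v}"
  shows "finite (closed_segment (cis s) (cis t) \<inter> closed_segment (cis u) (cis v))"
proof -
  let ?S = "chord_side s t"
  have unique: "z = z'" if z: "z \<in> closed_segment (cis s) (cis t) \<inter> closed_segment (cis u) (cis v)"
    and z': "z' \<in> closed_segment (cis s) (cis t) \<inter> closed_segment (cis u) (cis v)" for z z'
  proof -
    obtain l where l: "z = (1 - l) *\<^sub>R cis u + l *\<^sub>R cis v"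
      using z by (auto simp: closed_segment_def)
    obtain l' where l': "z' = (1 - l') *\<^sub>R cis u + l' *\<^sub>R cis v"
      using z' by (auto simp: closed_segment_def)
    have eqs: "(1 - l) * ?S (cis u) + l * ?S (cis v) = 0" "(1 - l') * ?S (cis u) + l' * ?S (cis v) = 0"
      using chord_side_on_chord[of z s t] chord_side_on_chord[of z' s t] z z'
      by (simp_all add: l l' chord_side_segment)
    then have "(l - l') * (?S (cis v) - ?S (cis u)) = 0"
      by (simp add: algebra_simps)
    moreover have "?S (cis v) \<noteq> ?S (cis u)"
    proof
      assume "?S (cis v) = ?S (cis u)"
      with eqs have "?S (cis u) = 0" "?S (cis v) = 0"
        by (auto simp: algebra_simps)
      then have "u \<in> {s, t}" "v \<in> {s, t}"
        using window chord_side_sgn(1) by blast+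
      with assms show False
        by auto
    qed
    ultimately show ?thesis
      by (simp add: l l')
  qed
  then show ?thesis
    by (metis finite.emptyI finite_insert finite_subset insertI1 subsetI equals0I)
qed

section \<open>Drawings with straight edges\<close>

definition chord_drawing :: "('a \<Rightarrow> real) \<Rightarrow> 'a drawing" where
  "chord_drawing \<theta> = \<lparr>centre = 0, radius = 1, pos = (\<lambda>v. cis (\<theta> v)),
     curve = (\<lambda>e. let (a, b) = (SOME (a, b). e = {a, b}) in linepath (cis (\<theta> a)) (cis (\<theta> b)))\<rparr>"

lemma chord_drawing_simps [simp]:
  "centre (chord_drawing \<theta>) = 0" "radius (chord_drawing \<theta>) = 1"
  "pos (chord_drawing \<theta>) v = cis (\<theta> v)"
  by (simp_all add: chord_drawing_def)

text \<open>An edge is an unordered set, so its direction in the drawing comes from an arbitrary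
  choice.\<close>

lemma chord_drawing_curve:
  "curve (chord_drawing \<theta>) {a, b} \<in>
    {linepath (cis (\<theta> a)) (cis (\<theta> b)), linepath (cis (\<theta> b)) (cis (\<theta> a))}"
proof -
  have "{a, b} = {fst p, snd p}" if "p = (SOME (c, d). {a, b} = {c, d})" for p
    unfolding that using someI[of "\<lambda>(c, d). {a, b} = {c, d}" "(a, b)"] by (auto simp: split_beta)
  then show ?thesis
    by (fastforce simp: chord_drawing_def split_beta doubleton_eq_iff)
qed

lemma path_image_chord_drawing:
  "path_image (curve (chord_drawing \<theta>) {a, b}) = closed_segment (cis (\<theta> a)) (cis (\<theta> b))"
  using chord_drawing_curve[of \<theta> a b] by (auto simp: closed_segment_commute)

lemma simple_graph_edge:
  assumes "simple_graph V E" "e \<in> E"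
  obtains a b where "e = {a, b}" "a \<noteq> b" "a \<in> V" "b \<in> V"
  using assms unfolding simple_graph_def card_2_iff by (metis insert_subset)

text \<open>With all angles within less than one turn, distinct angles give distinct points, and
  their linear order is the circular order cut open once.\<close>

locale chord_layout =
  fixes V :: "'a set" and E :: "'a set set" and \<theta> :: "'a \<Rightarrow> real"
  assumes simple: "simple_graph V E"
    and inj: "inj_on \<theta> V"
    and window: "\<And>v w. v \<in> V \<Longrightarrow> w \<in> V \<Longrightarrow> \<bar>\<theta> v - \<theta> w\<bar> < 2 * pi"
begin

lemma inj_cis: "inj_on (\<lambda>v. cis (\<theta> v)) V"
  using inj window cis_neq_less_2pi by (meson inj_on_def)

text \<open>Without interleaving, \<open>chords_meet\<close> leaves only common ends as meeting
  points, and these do not count as crossings.\<close>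

lemma crosses_interleaved:
  assumes "{a, b} \<in> E" "{c, d} \<in> E" "crosses (chord_drawing \<theta>) {a, b} {c, d}"
  shows "interleaved (\<theta> a) (\<theta> b) (\<theta> c) (\<theta> d)"
proof (rule ccontr)
  assume not: "\<not> ?thesis"
  have V: "a \<in> V" "b \<in> V" "c \<in> V" "d \<in> V" "c \<noteq> d"
    using assms simple by (auto elim!: simple_graph_edge[OF simple] simp: doubleton_eq_iff)
  obtain z where z: "z \<in> closed_segment (cis (\<theta> a)) (cis (\<theta> b))" "z \<in> closed_segment (cis (\<theta> c)) (cis (\<theta> d))"
    and z': "z \<notin> (\<lambda>v. cis (\<theta> v)) ` ({a, b} \<inter> {c, d})" and ne: "{a, b} \<noteq> {c, d}"
    using assms(3) by (auto simp: crosses_def crossing_points_def path_image_chord_drawing)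
  have "\<theta> ` {a, b} \<noteq> \<theta> ` {c, d}"
    using ne V inj inj_on_image_eq_iff[of \<theta> V "{a, b}" "{c, d}"] by auto
  moreover have "\<theta> c \<noteq> \<theta> d"
    using V inj by (auto dest: inj_onD)
  ultimately have "z \<in> cis ` ({\<theta> a, \<theta> b} \<inter> {\<theta> c, \<theta> d})"
    using V window not by (intro chords_meet[OF z]) auto
  moreover have "{\<theta> a, \<theta> b} \<inter> {\<theta> c, \<theta> d} = \<theta> ` ({a, b} \<inter> {c, d})"
    using inj_on_image_Int[OF inj, of "{a, b}" "{c, d}"] V by simp
  ultimately show False
    using z' by (simp add: image_image)
qed

lemma disk_drawing: "disk_drawing V E (chord_drawing \<theta>)"
  unfolding disk_drawing_def
proof (intro conjI ballI impI)
  show "inj_on (pos (chord_drawing \<theta>)) V"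
    using inj_cis by (simp add: inj_on_def)
next
  fix e assume "e \<in> E"
  then obtain a b where e: "e = {a, b}" "a \<noteq> b" "a \<in> V" "b \<in> V"
    using simple_graph_edge[OF simple] by metis
  have "cis (\<theta> a) \<noteq> cis (\<theta> b)"
    using inj_cis e by (auto dest: inj_onD)
  then show "arc (curve (chord_drawing \<theta>) e)"
    using chord_drawing_curve[of \<theta> a b] e by auto
  show ends: "{pathstart (curve (chord_drawing \<theta>) e), pathfinish (curve (chord_drawing \<theta>) e)}
      = pos (chord_drawing \<theta>) ` e"
    using chord_drawing_curve[of \<theta> a b] e by auto
  show "path_image (curve (chord_drawing \<theta>) e) \<subseteq> cball (centre (chord_drawing \<theta>)) (radius (chord_drawing \<theta>))"
    unfolding e path_image_chord_drawing by (intro closed_segment_subset) auto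
  \<comment> \<open>A vertex on the chord is a zero of \<open>chord_side\<close>, hence an
    end.\<close>
  have "v \<in> {a, b}" if "v \<in> V" "cis (\<theta> v) \<in> closed_segment (cis (\<theta> a)) (cis (\<theta> b))" for v
    using chord_side_on_chord[OF that(2)] chord_side_sgn(1)[of "\<theta> v" "\<theta> a" "\<theta> b"] window that e inj
    by (auto dest: inj_onD)
  moreover have "pos (chord_drawing \<theta>) ` e \<subseteq> path_image (curve (chord_drawing \<theta>) e)"
    unfolding e path_image_chord_drawing by auto
  ultimately show "path_image (curve (chord_drawing \<theta>) e) \<inter> pos (chord_drawing \<theta>) ` V
      = pos (chord_drawing \<theta>) ` e"
    using e by (auto simp: path_image_chord_drawing)
next
  fix e f assume "e \<in> E" "f \<in> E" "e \<noteq> f"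
  obtain a b where e: "e = {a, b}" "a \<in> V" "b \<in> V"
    using simple_graph_edge[OF simple \<open>e \<in> E\<close>] by metis
  obtain c d where f: "f = {c, d}" "c \<noteq> d" "c \<in> V" "d \<in> V"
    using simple_graph_edge[OF simple \<open>f \<in> E\<close>] by metis
  have "\<theta> ` {a, b} \<noteq> \<theta> ` {c, d}"
    using \<open>e \<noteq> f\<close> e f inj inj_on_image_eq_iff[of \<theta> V "{a, b}" "{c, d}"] by auto
  moreover have "\<theta> c \<noteq> \<theta> d"
    using f inj by (auto dest: inj_onD)
  ultimately show "finite (path_image (curve (chord_drawing \<theta>) e) \<inter> path_image (curve (chord_drawing \<theta>) f))"
    unfolding e f path_image_chord_drawing using e f window
    by (intro finite_chords_inter) auto
qed auto

end

section \<open>Crossings and interleaving angles\<close>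

lemma interleaved_antimono:
  fixes \<theta> :: "nat \<Rightarrow> real"
  assumes "\<And>i j. i < j \<Longrightarrow> \<theta> j < \<theta> i"
  shows "interleaved (\<theta> i) (\<theta> j) (\<theta> k) (\<theta> l) \<longleftrightarrow> interleaved i j k l"
proof -
  have "\<theta> i < \<theta> j \<longleftrightarrow> j < i" "\<theta> i = \<theta> j \<longleftrightarrow> i = j" for i j
    using assms[of i j] assms[of j i] by (cases i j rule: linorder_cases; force)+
  then show ?thesis
    by (auto simp: interleaved_def strictly_between_def)
qed

text \<open>The curves meet by \<open>disk_paths_meet\<close>. The edges have no common end, so
  every meeting point is a crossing.\<close>

lemma interleaved_edges_cross:
  assumes D: "disk_drawing V E D"
    and T: "\<And>v. v \<in> V \<Longrightarrow> pos D v = centre D + of_real (radius D) * cis (T v)"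
    and window: "\<And>v w. v \<in> V \<Longrightarrow> w \<in> V \<Longrightarrow> T v < T w + 2 * pi"
    and edges: "{a, b} \<in> E" "{c, d} \<in> E" "{a, b, c, d} \<subseteq> V"
    and il: "interleaved (T a) (T b) (T c) (T d)"
  shows "crosses D {a, b} {c, d}"
proof -
  have e: "arc (curve D {a, b})" "path_image (curve D {a, b}) \<subseteq> cball (centre D) (radius D)"
      "{pathstart (curve D {a, b}), pathfinish (curve D {a, b})} = pos D ` {a, b}"
    and f: "arc (curve D {c, d})" "path_image (curve D {c, d}) \<subseteq> cball (centre D) (radius D)"
      "{pathstart (curve D {c, d}), pathfinish (curve D {c, d})} = pos D ` {c, d}"
    and r: "0 < radius D"
    using D edges unfolding disk_drawing_def by blast+
  have "path_image (curve D {a, b}) \<inter> path_image (curve D {c, d}) \<noteq> {}"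
    by (rule disk_paths_meet[OF _ _ _ r _ _ il])
      (use e f edges T window in \<open>auto simp: arc_imp_path\<close>)
  moreover have "{a, b} \<inter> {c, d} = {}" "{a, b} \<noteq> {c, d}"
    using il by (auto simp: interleaved_def doubleton_eq_iff)
  ultimately show ?thesis
    by (simp add: crosses_def crossing_points_def)
qed

text \<open>Moves the angles from list positions to vertices. They all lie above
  \<open>t 0 - 2 * pi\<close> and do not exceed \<open>t 0\<close>, hence the bound on their
  differences.\<close>

lemma clockwise_order_angles:
  assumes "clockwise_order V D vs"
  obtains T where "inj_on T V" "\<And>v. v \<in> V \<Longrightarrow> pos D v = centre D + of_real (radius D) * cis (T v)"
    "\<And>v w. v \<in> V \<Longrightarrow> w \<in> V \<Longrightarrow> T v < T w + 2 * pi"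
proof -
  obtain t :: "nat \<Rightarrow> real" where vs: "distinct vs" "set vs = V"
    and pos: "\<And>i. i < length vs \<Longrightarrow> pos D (vs ! i) = centre D + of_real (radius D) * cis (t i)"
    and dec: "\<And>i j. i < j \<Longrightarrow> j < length vs \<Longrightarrow> t j < t i"
    and win: "\<And>i. i < length vs \<Longrightarrow> t 0 - 2 * pi < t i"
    using assms unfolding clockwise_order_def by blast
  define idx where "idx = inv_into {..<length vs} ((!) vs)"
  have idx: "idx v < length vs" "vs ! idx v = v" if "v \<in> V" for v
  proof -
    have "v \<in> (!) vs ` {..<length vs}"
      using that vs by (auto simp: in_set_conv_nth)
    then show "idx v < length vs" "vs ! idx v = v"
      unfolding idx_def using inv_into_into f_inv_into_f by (metis lessThan_iff)+
  qed
  have le: "t i \<le> t 0" if "i < length vs" for i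
    using dec[of 0 i] that by (cases i) auto
  show thesis
  proof (rule that[of "t \<circ> idx"])
    show "inj_on (t \<circ> idx) V"
    proof (rule inj_onI)
      fix v w assume "v \<in> V" "w \<in> V" "(t \<circ> idx) v = (t \<circ> idx) w"
      then have "idx v = idx w"
        using dec idx by (metis comp_apply less_irrefl nat_neq_iff)
      then show "v = w"
        using idx \<open>v \<in> V\<close> \<open>w \<in> V\<close> by metis
    qed
    show "pos D v = centre D + of_real (radius D) * cis ((t \<circ> idx) v)" if "v \<in> V" for v
      using pos idx[OF that] by (metis comp_apply)
    show "(t \<circ> idx) v < (t \<circ> idx) w + 2 * pi" if "v \<in> V" "w \<in> V" for v w
      using le[of "idx v"] win[of "idx w"] idx that by fastforce
  qed
qed

section \<open>Redrawing along the hamiltonian cycle\<close>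

theorem theorem2p3:
  fixes V :: "'a set" and E C :: "'a set set" and D :: "'a drawing" and vs :: "'a list"
  assumes "simple_graph V E"
    and "two_connected V E"
    and "pseudo_outerplanar_diagram V E D"
    and "clockwise_order V D vs"
    and "hamiltonian_cycle V E C"
    and "C \<noteq> cycle_edges vs"
  shows "\<exists>D' us. hamiltonian_diagram V E D' us \<and> cycle_edges us = C"
proof -
  have D: "disk_drawing V E D"
    and D_unique: "\<And>e f g. e \<in> E \<Longrightarrow> f \<in> E \<Longrightarrow> g \<in> E \<Longrightarrow> crosses D e f \<Longrightarrow> crosses D e g \<Longrightarrow> f = g"
    using assms(3) unfolding pseudo_outerplanar_diagram_def pseudo_outerplanar_drawing_def by blast+
  obtain T where T_inj: "inj_on T V"
    and T_pos: "\<And>v. v \<in> V \<Longrightarrow> pos D v = centre D + of_real (radius D) * cis (T v)"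
    and T_window: "\<And>v w. v \<in> V \<Longrightarrow> w \<in> V \<Longrightarrow> T v < T w + 2 * pi"
    using clockwise_order_angles[OF assms(4)] by blast
  obtain us where us: "3 \<le> length us" "distinct us" "set us = V" "C = cycle_edges us" "cycle_edges us \<subseteq> E"
    using assms(5) unfolding hamiltonian_cycle_def by blast
  define n where "n = length us"
  have n: "0 < n"
    using us(1) by (auto simp: n_def)
  \<comment> \<open>The indices follow the cycle while the values are angles in the given drawing,
    so the locale compares the two cyclic orders.\<close>
  define x where "x i = T (us ! (i mod n))" for i
  define F where "F = (`) T ` E"
  have us_V: "us ! i \<in> V" if "i < n" for i
    using that us by (auto simp: n_def)
  have F_edge: "\<exists>p q. {p, q} \<in> E \<and> {p, q} \<subseteq> V \<and> a = T p \<and> b = T q"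
    if ab: "{a, b} \<in> F" for a b
  proof -
    obtain e where e: "e \<in> E" "{a, b} = T ` e"
      using ab unfolding F_def by blast
    obtain p q where pq: "e = {p, q}" "p \<in> V" "q \<in> V"
      using simple_graph_edge[OF assms(1) e(1)] by metis
    have "a = T p \<and> b = T q \<or> a = T q \<and> b = T p"
      using e(2) pq(1) by (simp add: doubleton_eq_iff)
    moreover have "{p, q} \<in> E" "{q, p} \<in> E"
      using e(1) pq(1) by (simp_all add: insert_commute)
    ultimately show ?thesis
      using pq by blast
  qed
  interpret closed_walk_chords n x F
  proof
    show "x i = x j \<longleftrightarrow> i mod n = j mod n" for i j
    proof -
      have "x i = x j \<longleftrightarrow> us ! (i mod n) = us ! (j mod n)"
        unfolding x_def using inj_on_eq_iff[OF T_inj] us_V n by simp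
      also have "\<dots> \<longleftrightarrow> i mod n = j mod n"
        using us n by (simp add: nth_eq_iff_index_eq n_def)
      finally show ?thesis .
    qed
    show "{x i, x (Suc i)} \<in> F" for i
    proof -
      have "{us ! (i mod n), us ! (Suc (i mod n) mod n)} \<in> cycle_edges us"
        unfolding cycle_edges_def n_def using n by (auto simp: n_def intro!: exI[of _ "i mod length us"])
      then have "T ` {us ! (i mod n), us ! (Suc (i mod n) mod n)} \<in> F"
        using us(5) unfolding F_def by blast
      then show ?thesis
        by (simp add: x_def mod_Suc_eq)
    qed
    fix a b c d c' d'
    assume F: "{a, b} \<in> F" "{c, d} \<in> F" "{c', d'} \<in> F" and "interleaved a b c d" "interleaved a b c' d'"
    moreover obtain p q where "{p, q} \<in> E" "{p, q} \<subseteq> V" "a = T p" "b = T q"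
      using F_edge[OF F(1)] by blast
    moreover obtain u v where "{u, v} \<in> E" "{u, v} \<subseteq> V" "c = T u" "d = T v"
      using F_edge[OF F(2)] by blast
    moreover obtain u' v' where "{u', v'} \<in> E" "{u', v'} \<subseteq> V" "c' = T u'" "d' = T v'"
      using F_edge[OF F(3)] by blast
    ultimately have "{u, v} = {u', v'}"
      by (intro D_unique[of "{p, q}"] interleaved_edges_cross[OF D T_pos T_window]) auto
    then have "T ` {u, v} = T ` {u', v'}"
      by simp
    then show "{c, d} = {c', d'}"
      using \<open>c = T u\<close> \<open>d = T v\<close> \<open>c' = T u'\<close> \<open>d' = T v'\<close> by simp
  qed
  define idx where "idx = inv_into {..<n} ((!) us)"
  \<comment> \<open>Equally spaced clockwise angles, starting at 0 and covering less than one
    turn.\<close>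
  define t where "t i = - (2 * pi * real i / real n)" for i
  define D' where "D' = chord_drawing (t \<circ> idx)"
  have bij: "bij_betw ((!) us) {..<n} V"
    using us bij_betw_nth[of us "{..<n}" V] by (simp add: n_def)
  have idx: "idx v < n" "us ! idx v = v" if "v \<in> V" for v
    using bij_betw_inv_into_right[OF bij that] bij_betw_apply[OF bij_betw_inv_into[OF bij] that]
    by (simp_all add: idx_def)
  have idx_nth: "idx (us ! i) = i" if "i < n" for i
    using bij_betw_inv_into_left[OF bij] that by (simp add: idx_def)
  have t_less: "t j < t i" if "i < j" for i j
    using that n by (simp add: t_def divide_strict_right_mono)
  have t_bounds: "t i \<le> 0" "- (2 * pi) < t i" if "i < n" for i
    using that n by (simp_all add: t_def field_simps)
  interpret chord_layout V E "t \<circ> idx"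
  proof
    show "inj_on (t \<circ> idx) V"
      using idx t_less by (intro inj_onI) (metis comp_apply less_irrefl nat_neq_iff)
    show "\<bar>(t \<circ> idx) v - (t \<circ> idx) w\<bar> < 2 * pi" if "v \<in> V" "w \<in> V" for v w
      using t_bounds[of "idx v"] t_bounds[of "idx w"] idx that by fastforce
  qed (fact assms(1))
  \<comment> \<open>The angles decrease along the cycle; reversing the order preserves
    interleaving.\<close>
  have cross_idx: "interleaved (idx a) (idx b) (idx c) (idx d)"
    if "{a, b} \<in> E" "{c, d} \<in> E" "crosses D' {a, b} {c, d}" for a b c d
    using crosses_interleaved[of a b c d] that interleaved_antimono[of t, OF t_less] by (simp add: D'_def)
  have D'_unique: "f = g" if "e \<in> E" "f \<in> E" "g \<in> E" and cr: "crosses D' e f" "crosses D' e g" for e f g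
  proof -
    obtain a b where e: "e = {a, b}" "a \<in> V" "b \<in> V"
      using simple_graph_edge[OF assms(1) \<open>e \<in> E\<close>] by metis
    obtain c d where f: "f = {c, d}" "c \<in> V" "d \<in> V"
      using simple_graph_edge[OF assms(1) \<open>f \<in> E\<close>] by metis
    obtain c' d' where g: "g = {c', d'}" "c' \<in> V" "d' \<in> V"
      using simple_graph_edge[OF assms(1) \<open>g \<in> E\<close>] by metis
    have x_idx: "x (idx v) = T v" if "v \<in> V" for v
      using idx[OF that] by (simp add: x_def)
    have in_F: "{T v, T w} \<in> F" if "{v, w} \<in> E" for v w
      using imageI[OF that, of "(`) T"] by (simp add: F_def)
    \<comment> \<open>Edges crossing in the new drawing interleave as positions on the cycle, so
      \<open>f\<close> and \<open>g\<close> have the same angles in the given drawing.\<close>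
    have "{x (idx c), x (idx d)} = {x (idx c'), x (idx d')}"
      by (rule interleaving_chord_unique[of "idx a" "idx b"])
        (use e f g that cross_idx in \<open>auto simp: idx x_idx in_F\<close>)
    then have "T ` f = T ` g"
      using f g by (simp add: x_idx)
    then show ?thesis
      using inj_on_image_eq_iff[OF T_inj, of f g] f g by blast
  qed
  have "clockwise_order V D' us"
    unfolding clockwise_order_def
  proof (intro conjI exI[of _ t] allI impI)
    show "pos D' (us ! i) = centre D' + complex_of_real (radius D') * cis (t i)" if "i < length us" for i
      using that idx_nth by (simp add: D'_def n_def)
    show "t 0 - 2 * pi < t i" if "i < length us" for i
      using t_bounds(2)[of i] that by (simp add: t_def n_def)
  qed (use us t_less in auto)
  moreover have "pseudo_outerplanar_drawing V E D'"
    using disk_drawing D'_unique unfolding pseudo_outerplanar_drawing_def D'_def by blast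
  ultimately show ?thesis
    using us unfolding hamiltonian_diagram_def by blast
qed

end
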